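(* Let $q$ be a complex number with $|q|=1$ that is not a root of unity, and let $p$ be a real number with $0<p<1$. For $n=0,1,2,\dots$ let $$\Phi_n(z)=p^n\,\frac{(p^{-1};q)_n}{(pq;q)_n}\;{_2}\phi_1\left({q^{-n},\,pq \atop pq^{1-n}};\,zq\right),$$ and for nonnegative integers $s$ put $$g_s=\frac{q^s-p}{1-pq^{s+1}},\qquad d_s=-\frac{p(1-q^s)^2}{(1-pq^s)(1-pq^{s+1})},\qquad B_s=\frac{p(1-q^s)}{1-pq^s}.$$ Then for all integers $n\ge 0$ and $s\ge 0$ the polynomials satisfy the second-order $q$-difference equation $$B_{s+1}\,\Phi_n(q^{s+1})+g_s\,\Phi_n(q^s)=q^n\left(\Phi_n(q^s)+B_s^{-1}d_s\,\Phi_n(q^{s-1})\right),$$ where for $s=0$ the coefficient $B_s^{-1}d_s$ is understood as $0$.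
   Context: The $q$-shifted factorial is $(a;q)_0=1$ and $(a;q)_n=(1-a)(1-aq)\cdots(1-aq^{n-1})$ for $n\ge 1$. The basic hypergeometric function (with base $q$) is $${_2}\phi_1\left({a_1,a_2\atop b_1};z\right)=\sum_{k=0}^{\infty}\frac{(a_1;q)_k(a_2;q)_k}{(q;q)_k(b_1;q)_k}z^k ;$$ when $a_1=q^{-n}$ with $n$ a nonnegative integer, the series terminates and denotes the finite sum over $0\le k\le n$. The polynomials $\Phi_n$ are the monic polynomials orthogonal on the unit circle with respect to the probability measure having mass $(1-p)p^s$ at the point $q^s$, $s=0,1,2,\dots$. For $s\ge1$, $B_s\neq 0$ and $B_s^{-1}d_s=-\frac{1-q^s}{1-pq^{s+1}}$; this last expression equals $0$ at $s=0$, which is the meaning given to $B_0^{-1}d_0$. *)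

theory Defs
  imports Complex_Main
begin

definition qpoch :: "complex \<Rightarrow> complex \<Rightarrow> nat \<Rightarrow> complex" where
  "qpoch q a n = (\<Prod>i<n. 1 - a * q ^ i)"

text \<open>
  The basic hypergeometric series with base \<open>q\<close>. If \<open>a1 = q\<^sup>-\<^sup>n\<close> with \<open>q \<noteq> 0\<close>, the factor
  \<open>qpoch q a1 k\<close> vanishes for every \<open>k > n\<close>, so \<open>suminf\<close> is the sum over \<open>0 \<le> k \<le> n\<close>
  and no convergence condition is needed.
\<close>

definition phi21 :: "complex \<Rightarrow> complex \<Rightarrow> complex \<Rightarrow> complex \<Rightarrow> complex \<Rightarrow> complex" where
  "phi21 q a1 a2 b1 z =
     (\<Sum>k. qpoch q a1 k * qpoch q a2 k / (qpoch q q k * qpoch q b1 k) * z ^ k)"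

definition Phi :: "complex \<Rightarrow> real \<Rightarrow> nat \<Rightarrow> complex \<Rightarrow> complex" where
  "Phi q p n z =
     of_real p ^ n * (qpoch q (inverse (of_real p)) n / qpoch q (of_real p * q) n) *
     phi21 q (q powi (- int n)) (of_real p * q) (of_real p * q powi (1 - int n)) (z * q)"

definition g_coeff :: "complex \<Rightarrow> real \<Rightarrow> nat \<Rightarrow> complex" where
  "g_coeff q p s = (q ^ s - of_real p) / (1 - of_real p * q ^ (s + 1))"

definition d_coeff :: "complex \<Rightarrow> real \<Rightarrow> nat \<Rightarrow> complex" where
  "d_coeff q p s = - (of_real p * (1 - q ^ s)\<^sup>2 /
     ((1 - of_real p * q ^ s) * (1 - of_real p * q ^ (s + 1))))"

definition B_coeff :: "complex \<Rightarrow> real \<Rightarrow> nat \<Rightarrow> complex" where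
  "B_coeff q p s = of_real p * (1 - q ^ s) / (1 - of_real p * q ^ s)"

end

theory Submission
  imports Defs
begin

text \<open>
  With \<open>x = q\<^sup>s\<close> and denominators cleared, the equation is
  \<open>p (1 - q x) \<Phi>(q x) + (x - p) \<Phi>(x) = q\<^sup>n ((1 - p q x) \<Phi>(x) - (1 - x) \<Phi>(x/q))\<close>.
  If \<open>c\<^sub>k\<close> is the coefficient of \<open>x\<^sup>k\<close> in \<open>\<Phi>\<close>, the two sides differ at \<open>x\<^sup>k\<close> by
  \<open>A k - c\<^sub>k\<^sub>-\<^sub>1 (1 - p q\<^sup>k) (q\<^sup>n\<^sup>-\<^sup>k\<^sup>+\<^sup>1 - 1)\<close> with \<open>A k = c\<^sub>k (1 - q\<^sup>k) (q\<^sup>n\<^sup>-\<^sup>k - p)\<close>,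
  and this vanishes by the first-order recurrence for \<open>c\<^sub>k\<close>.
\<close>

lemma qpoch_Suc: "qpoch q a (Suc k) = qpoch q a k * (1 - a * q ^ k)"
  by (simp add: qpoch_def)

lemma qpoch_neg_power_eq_0:
  assumes "q \<noteq> 0" and "n < k"
  shows "qpoch q (q powi (- int n)) k = 0"
  using assms by (auto simp: qpoch_def power_int_minus intro!: bexI[of _ n])

lemma phi21_terminating:
  assumes "q \<noteq> 0"
  shows "phi21 q (q powi (- int n)) a b z =
    (\<Sum>k\<le>n. qpoch q (q powi (- int n)) k * qpoch q a k / (qpoch q q k * qpoch q b k) * z ^ k)"
  unfolding phi21_def by (rule suminf_finite) (auto simp: qpoch_neg_power_eq_0[OF assms])

text \<open>The equation is linear and homogeneous in \<Phi>, so it suffices to treat the series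
  without its prefactor. Assumption \<open>pq\<close> is exactly what keeps the lower-parameter
  factors \<open>1 - b * q ^ k\<close> nonzero.\<close>

lemma phi21_q_difference:
  fixes q p x :: complex
  assumes q0: "q \<noteq> 0"
    and q1: "\<And>m. m \<ge> 1 \<Longrightarrow> q ^ m \<noteq> 1"
    and pq: "\<And>m. p * q ^ m \<noteq> q ^ n"
  defines "F \<equiv> \<lambda>x. phi21 q (q powi (- int n)) (p * q) (p * q powi (1 - int n)) (x * q)"
  shows "p * (1 - q * x) * F (q * x) + (x - p) * F x
       = q ^ n * ((1 - p * q * x) * F x - (1 - x) * F (x / q))"
proof -
  define a where "a = q powi (- int n)"
  define b where "b = p * q powi (1 - int n)"
  define c where "c k = qpoch q a k * qpoch q (p * q) k / (qpoch q q k * qpoch q b k) * q ^ k" for k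
  define A where "A k = c k * (1 - q ^ k) * (q ^ n / q ^ k - p)" for k
  have F: "F y = (\<Sum>k\<le>n. c k * y ^ k)" for y
    by (simp add: F_def phi21_terminating[OF q0] c_def a_def b_def power_mult_distrib mult_ac)
  have a: "a = 1 / q ^ n"
    by (simp add: a_def power_int_minus field_simps)
  have b: "b = p * q / q ^ n"
    using q0 by (simp add: b_def power_int_diff)
  have rec: "A (Suc k) = c k * (1 - p * q ^ Suc k) * (q ^ n / q ^ k - 1)" for k
  proof -
    have 1: "1 - q * q ^ k \<noteq> 0"
      using q1[of "Suc k"] by auto
    have 2: "1 - b * q ^ k \<noteq> 0"
      using pq[of "Suc k"] q0 by (auto simp: b field_simps)
    \<comment> \<open>This form exposes the factor that cancels a denominator of
      \<open>c (Suc k)\<close>; fact \<open>4\<close> does the same for the numerator factor with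
      \<open>a\<close>.\<close>
    have 3: "q ^ n / q ^ Suc k - p = q ^ n / q ^ Suc k * (1 - b * q ^ k)"
      using q0 by (simp add: b field_simps)
    have 4: "q ^ n / q ^ k - 1 = q ^ n / q ^ k * (1 - a * q ^ k)"
      using q0 by (simp add: a field_simps)
    have c: "c (Suc k) = c k * (q * (1 - a * q ^ k) * (1 - p * q * q ^ k)
               / ((1 - q * q ^ k) * (1 - b * q ^ k)))"
      by (simp add: c_def qpoch_Suc mult_ac)
    show ?thesis
      unfolding A_def 3 4 c using 1 2 q0 by simp
  qed
  have "p * (1 - q * x) * F (q * x) + (x - p) * F x
          - q ^ n * ((1 - p * q * x) * F x - (1 - x) * F (x / q))
      = (\<Sum>k\<le>n. p * (1 - q * x) * (c k * (q * x) ^ k) + (x - p) * (c k * x ^ k)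
          - q ^ n * ((1 - p * q * x) * (c k * x ^ k) - (1 - x) * (c k * (x / q) ^ k)))"
    by (simp only: F sum.distrib sum_subtractf flip: sum_distrib_left)
  \<comment> \<open>Each term \<open>c k * x ^ k\<close> contributes only in degrees
    \<open>k\<close> and \<open>Suc k\<close>. By \<open>rec\<close> its second contribution is the
    negative of the first contribution of the next term, so the sum telescopes.\<close>
  also have "\<dots> = (\<Sum>k\<le>n. A k * x ^ k - A (Suc k) * x ^ Suc k)"
    unfolding rec using q0
    by (intro sum.cong refl)
       (simp add: A_def power_mult_distrib power_divide field_simps)
  also have "\<dots> = A 0 * x ^ 0 - A (Suc n) * x ^ Suc n"
    by (rule sum_telescope)
  \<comment> \<open>\<open>A 0\<close> contains \<open>1 - q ^ 0\<close>; by \<open>rec\<close> at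
    \<open>k = n\<close>, \<open>A (Suc n)\<close> contains
    \<open>q ^ n / q ^ n - 1\<close>.\<close>
  also have "\<dots> = 0"
    using q0 unfolding rec by (simp add: A_def)
  finally show ?thesis
    by simp
qed

theorem mainTheorem3:
  fixes q :: complex and p :: real and n s :: nat
  assumes "norm q = 1"
    and "\<forall>m::nat. m \<ge> 1 \<longrightarrow> q ^ m \<noteq> 1"
    and "0 < p" and "p < 1"
  shows "B_coeff q p (s + 1) * Phi q p n (q ^ (s + 1)) + g_coeff q p s * Phi q p n (q ^ s)
       = q ^ n * (Phi q p n (q ^ s)
           + (if s = 0 then 0 else inverse (B_coeff q p s) * d_coeff q p s)
             * Phi q p n (q powi (int s - 1)))"
proof -
  define P where "P = complex_of_real p"
  define x where "x = q ^ s"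
  define F where "F y = phi21 q (q powi (- int n)) (P * q) (P * q powi (1 - int n)) (y * q)" for y
  define C where "C = P ^ n * (qpoch q (inverse P) n / qpoch q (P * q) n)"
  have q0: "q \<noteq> 0"
    using assms(1) by auto
  have P0: "P \<noteq> 0"
    using assms(3) by (simp add: P_def)
  \<comment> \<open>The moduli are \<open>p < 1\<close> and 1.\<close>
  have pq: "P * q ^ m \<noteq> q ^ k" for m k
  proof
    assume "P * q ^ m = q ^ k"
    then have "norm (P * q ^ m) = norm (q ^ k)" by simp
    then show False
      using assms by (simp add: P_def norm_mult norm_power)
  qed
  have D: "1 - P * q ^ k \<noteq> 0" for k
    using pq[of k 0] by auto
  have Phi: "Phi q p n y = C * F y" for y
    by (simp add: Phi_def C_def F_def P_def)
  have E: "P * (1 - q * x) * F (q * x) + (x - P) * F x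
       = q ^ n * ((1 - P * q * x) * F x - (1 - x) * F (x / q))"
    unfolding F_def using q0 assms(2) pq by (intro phi21_q_difference) auto
  have B: "B_coeff q p (s + 1) = P * (1 - q * x) / (1 - P * q * x)"
    and g: "g_coeff q p s = (x - P) / (1 - P * q * x)"
    by (simp_all add: B_coeff_def g_coeff_def P_def x_def mult_ac)
  \<comment> \<open>At \<open>s = 0\<close> we have \<open>x = 1\<close>, so the closed form agrees
    with the convention and also removes the value at \<open>1 / q\<close>.\<close>
  have d: "(if s = 0 then 0 else inverse (B_coeff q p s) * d_coeff q p s)
      = - ((1 - x) / (1 - P * q * x))"
  proof (cases "s = 0")
    case True
    then show ?thesis by (simp add: x_def)
  next
    case False
    then have "1 - x \<noteq> 0"
      using assms(2) by (auto simp: x_def)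
    moreover have "d_coeff q p s = - (P * (1 - x) ^ 2 / ((1 - P * x) * (1 - P * q * x)))"
      and "B_coeff q p s = P * (1 - x) / (1 - P * x)"
      by (simp_all add: d_coeff_def B_coeff_def P_def x_def mult_ac)
    ultimately show ?thesis
      using False P0 D[of s] by (simp add: x_def[symmetric] power2_eq_square)
  qed
  have x_pred: "q powi (int s - 1) = x / q"
    using q0 by (simp add: x_def power_int_diff)
  have nz: "1 - P * q * x \<noteq> 0"
    using D[of "Suc s"] by (simp add: x_def mult_ac)
  have factor: "a / w * (C * u) + b / w * (C * v) = C / w * (a * u + b * v)" for a b u v w
    by (simp add: distrib_left mult_ac)
  \<comment> \<open>From here on, \<open>E\<close> is multiplied by
    \<open>C / (1 - P * q * x)\<close>, restoring prefactor and denominators.\<close>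
  have "B_coeff q p (s + 1) * Phi q p n (q * x) + g_coeff q p s * Phi q p n x
      = C / (1 - P * q * x) * (P * (1 - q * x) * F (q * x) + (x - P) * F x)"
    unfolding B g Phi by (rule factor)
  also have "\<dots> = q ^ n * (C * ((1 - P * q * x) * F x / (1 - P * q * x))
                   - (1 - x) / (1 - P * q * x) * (C * F (x / q)))"
    unfolding E by (simp add: diff_divide_distrib algebra_simps)
  also have "\<dots> = q ^ n * (Phi q p n x + - ((1 - x) / (1 - P * q * x)) * Phi q p n (x / q))"
    using nz by (simp add: Phi)
  finally show ?thesis
    unfolding d x_pred by (simp add: x_def)
qed

end
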